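(* (a) Let $X$ be any bounded subset of $\mathbb{R}^2$ and let $\eta>0$. Then the Gaussian kernel $K(x,y)=\exp\big(-(x-y)^2/\eta\big)$ admits a $(1,\infty)$-expansion on $X$; that is, for every bounded interval $I\subset\mathbb{R}$ with nonempty interior such that $X\subseteq I\times I$, the kernel $K$ admits a $(1,\infty)$-expansion on $I\times I$. (b) Let $F:[0,+\infty)\to\mathbb{R}$ be a function with $\lim_{r\to+\infty}F(r)=0$ such that $K(x,y)=F(|x-y|)$, $x,y\in\mathbb{R}$, is a positive semidefinite kernel on $\mathbb{R}\times\mathbb{R}$ which is not identically zero. Then $K$ does not admit a $(1,\infty)$-expansion on $\mathbb{R}\times\mathbb{R}=\mathbb{R}^2$. (c) For every $\eta>0$ and every real $p>1$, the Gaussian kernel $K(x,y)=\exp\big(-(x-y)^2/\eta\big)$, $x,y\in\mathbb{R}$, admits a $(p,\infty)$-expansion on $\mathbb{R}\times\mathbb{R}=\mathbb{R}^2$.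
   Context: Let $I\subseteq\mathbb{R}$ be an interval with nonempty interior (possibly $I=\mathbb{R}$). A positive semidefinite kernel on $I\times I$ is a symmetric function $K:I\times I\to\mathbb{R}$ such that $\sum_{i=1}^n\sum_{j=1}^n a_ia_jK(x_i,x_j)\ge 0$ for all integers $n\ge1$, all real $a_1,\dots,a_n$ and all $x_1,\dots,x_n\in I$. For $p\ge 1$, the kernel $K$ admits a $(p,\infty)$-expansion on $I\times I$ if there exist real numbers $\lambda_k\ge 0$ and functions $\psi_k:I\to\mathbb{R}$, $k=1,2,3,\dots$, such that: (1) $K(x,y)=\sum_{k=1}^{+\infty}\lambda_k\psi_k(x)\psi_k(y)$ for all $x,y\in I$, with pointwise convergence of the series; (2) $(\lambda_k)_{k\ge1}\in\ell_p$, i.e. $\sum_{k}\lambda_k^p<+\infty$; (3) the functions $\psi_k$, $k\ge 1$, are linearly independent (every finite subfamily is linearly independent); (4) there is a constant $M<+\infty$, independent of $k$, such that $\|\psi_k\|_\infty:=\sup_{x\in I}|\psi_k(x)|\le M$ for all $k$. *)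

theory Defs
  imports "HOL-Analysis.Analysis"
begin

text \<open>
  Functions on a set \<open>I\<close> are total functions on \<^typ>\<open>real\<close> of which only the values on \<open>I\<close>
  are ever used. Sequences are indexed from \<open>0\<close> instead of \<open>1\<close>.
\<close>

definition nondegenerate_interval :: "real set \<Rightarrow> bool" where
  "nondegenerate_interval I \<longleftrightarrow> is_interval I \<and> interior I \<noteq> {}"

definition psd_kernel_on :: "real set \<Rightarrow> (real \<Rightarrow> real \<Rightarrow> real) \<Rightarrow> bool" where
  "psd_kernel_on I K \<longleftrightarrow>
     (\<forall>x\<in>I. \<forall>y\<in>I. K x y = K y x) \<and>
     (\<forall>n\<ge>1. \<forall>(a :: nat \<Rightarrow> real) (x :: nat \<Rightarrow> real). (\<forall>i\<in>{1..n}. x i \<in> I) \<longrightarrow>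
        (\<Sum>i=1..n. \<Sum>j=1..n. a i * a j * K (x i) (x j)) \<ge> 0)"

text \<open>
  The library's \<^term>\<open>independent\<close> concerns sets of vectors; here we need independence of a family
  (which excludes repetitions) of functions restricted to \<open>I\<close>.
\<close>

definition linearly_independent_family_on :: "real set \<Rightarrow> (nat \<Rightarrow> real \<Rightarrow> real) \<Rightarrow> bool" where
  "linearly_independent_family_on I \<psi> \<longleftrightarrow>
     (\<forall>S c. finite S \<longrightarrow> (\<forall>x\<in>I. (\<Sum>k\<in>S. c k * \<psi> k x) = 0) \<longrightarrow> (\<forall>k\<in>S. c k = 0))"

text \<open>Extended-real valued, so that it is \<open>\<infinity>\<close> when the function is unbounded on \<open>I\<close>.\<close>

definition sup_norm_on :: "real set \<Rightarrow> (real \<Rightarrow> real) \<Rightarrow> ereal" where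
  "sup_norm_on I f = (SUP x\<in>I. ereal \<bar>f x\<bar>)"

text \<open>
  The \<open>(p,\<infinity>)\<close>-expansion on \<open>I \<times> I\<close>, meant for \<open>p \<ge> 1\<close>. Note that \<open>0 powr p = 0\<close>,
  so vanishing coefficients contribute nothing to the \<open>\<ell>\<^sub>p\<close> condition.
\<close>

definition admits_expansion_on :: "real \<Rightarrow> real set \<Rightarrow> (real \<Rightarrow> real \<Rightarrow> real) \<Rightarrow> bool" where
  "admits_expansion_on p I K \<longleftrightarrow>
     (\<exists>(\<Lambda> :: nat \<Rightarrow> real) (\<psi> :: nat \<Rightarrow> real \<Rightarrow> real).
        (\<forall>k. \<Lambda> k \<ge> 0) \<and>
        (\<forall>x\<in>I. \<forall>y\<in>I. (\<lambda>k. \<Lambda> k * \<psi> k x * \<psi> k y) sums K x y) \<and>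
        summable (\<lambda>k. \<Lambda> k powr p) \<and>
        linearly_independent_family_on I \<psi> \<and>
        (\<exists>M::real. \<forall>k. sup_norm_on I (\<psi> k) \<le> ereal M))"

definition gaussian_kernel :: "real \<Rightarrow> real \<Rightarrow> real \<Rightarrow> real" where
  "gaussian_kernel \<eta> x y = exp (- ((x - y)\<^sup>2 / \<eta>))"

end

theory Submission
  imports Defs
begin

text \<open>
  Expanding \<open>exp (2 x y / \<eta>)\<close> gives the features
  \<open>e\<^sub>k(x) = sqrt ((2/\<eta>)\<^sup>k / k!) x\<^sup>k exp (-x\<^sup>2/\<eta>)\<close> of the Gaussian kernel. On a bounded interval
  a rescaling of them already has summable coefficients, which is (a).

  For (b), the vectors \<open>(sqrt \<lambda>\<^sub>k \<psi>\<^sub>k(x))\<^sub>k\<close> would lie in a totally bounded subset of \<open>\<ell>\<^sub>2\<close>, whereas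
  points \<open>x\<close> that are far apart yield nearly orthogonal vectors of fixed positive norm.

  For (c), \<open>e\<^sub>k(x)\<^sup>2\<close> is the Poisson probability of \<open>k\<close> with mean \<open>t = 2 x\<^sup>2/\<eta>\<close>, so it is at most
  \<open>C exp (-(sqrt t - sqrt k)\<^sup>2) / sqrt k\<close>; the resulting coefficients \<open>1 / sqrt k\<close> are not good enough for
  \<open>p \<le> 2\<close>. Split the indices into consecutive blocks of length \<open>L\<^sup>2\<close> with \<open>L = 2\<^sup>m\<close>, so that \<open>k\<close> is of
  order \<open>L\<^sup>2\<close>. Within a residue class modulo \<open>L\<close> the numbers \<open>sqrt k\<close> are uniformly separated, hence
  at each point essentially boundedly many of the \<open>L\<close> features of the class are active. Mixing the
  class by the orthogonal matrix \<open>W / sqrt L\<close>, with \<open>W\<close> a Walsh--Hadamard matrix, preserves the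
  kernel and yields features of sup norm at most \<open>C / L\<close>. The coefficients \<open>1 / L\<^sup>2\<close> decay like \<open>1 / n\<close>.
\<close>

lemma sum_le_sums:
  fixes f :: "nat \<Rightarrow> real"
  assumes "f sums s" "\<And>n. f n \<ge> 0" "finite A"
  shows "sum f A \<le> s"
  using sum_le_suminf[OF sums_summable[OF assms(1)] assms(3)] sums_unique[OF assms(1)] assms(2) by simp

subsection \<open>Orthogonal mixing\<close>

text \<open>Sylvester's form: the sign is the parity of the number of binary positions below
  \<open>m\<close> at which \<open>i\<close> and \<open>j\<close> both have digit 1.\<close>

fun walsh :: "nat \<Rightarrow> nat \<Rightarrow> nat \<Rightarrow> real" where
  "walsh 0 i j = 1"
| "walsh (Suc m) i j = (if odd i \<and> odd j then - 1 else 1) * walsh m (i div 2) (j div 2)"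

lemma walsh_sym: "walsh m i j = walsh m j i"
  by (induction m arbitrary: i j) auto

lemma abs_walsh: "\<bar>walsh m i j\<bar> = 1"
  by (induction m arbitrary: i j) (auto simp: abs_mult)

lemma sum_lessThan_double:
  fixes f :: "nat \<Rightarrow> real"
  shows "(\<Sum>j<2 * n. f j) = (\<Sum>j<n. f (2 * j) + f (2 * j + 1))"
  by (induction n) auto

text \<open>Summing over the lowest digit of \<open>j\<close> gives the factor
  \<open>1 + s i * s i'\<close>, which is 2 or 0 according to whether the lowest digits of
  \<open>i\<close> and \<open>i'\<close> agree; the remaining digits are handled by
  induction.\<close>

lemma walsh_orthogonal:
  assumes "i < 2 ^ m" "i' < 2 ^ m"
  shows "(\<Sum>j<2 ^ m. walsh m i j * walsh m i' j) = (if i = i' then 2 ^ m else 0)"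
  using assms
proof (induction m arbitrary: i i')
  case (Suc m)
  define s where "s = (\<lambda>i :: nat. if odd i then - 1 else 1 :: real)"
  have "(\<Sum>j<2 ^ Suc m. walsh (Suc m) i j * walsh (Suc m) i' j)
      = (\<Sum>j<2 ^ m. (1 + s i * s i') * (walsh m (i div 2) j * walsh m (i' div 2) j))"
    unfolding power_Suc sum_lessThan_double
    by (intro sum.cong) (auto simp: s_def)
  also have "\<dots> = (1 + s i * s i') * (if i div 2 = i' div 2 then 2 ^ m else 0)"
    using Suc.prems by (subst Suc.IH[symmetric]) (auto simp: sum_distrib_left)
  also have "\<dots> = (if i = i' then 2 ^ Suc m else 0)"
  proof (cases "i div 2 = i' div 2 \<and> i \<noteq> i'")
    case True
    then have "odd i \<noteq> odd i'" by presburger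
    with True show ?thesis by (auto simp: s_def)
  qed (auto simp: s_def)
  finally show ?case .
qed auto

section \<open>Blocks of indices of lengths \<open>4 ^ m\<close>\<close>

definition block_start :: "nat \<Rightarrow> nat" where
  "block_start m = (\<Sum>i<m. 4 ^ i)"

lemma block_start_Suc: "block_start (Suc m) = block_start m + 4 ^ m"
  by (simp add: block_start_def)

text \<open>The geometric sum, free of division. It makes the indices of block \<open>m\<close>
  comparable with \<open>4 ^ m\<close>.\<close>

lemma block_start_closed: "3 * block_start m + 1 = 4 ^ m"
  by (induction m) (auto simp: block_start_def)

lemma block_start_mono: "m \<le> m' \<Longrightarrow> block_start m \<le> block_start m'"
  unfolding block_start_def by (intro sum_mono2) auto

lemma block_start_ge: "m \<le> block_start m"
proof (induction m)
  case (Suc m)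
  have "(1::nat) \<le> 4 ^ m" by simp
  with Suc show ?case unfolding block_start_Suc by linarith
qed simp

definition level :: "nat \<Rightarrow> nat" where
  "level n = (LEAST m. n < block_start (Suc m))"

lemma level_less: "n < block_start (Suc (level n))"
  unfolding level_def by (rule LeastI[of _ n]) (use block_start_ge[of "Suc n"] in simp)

lemma level_ge: "block_start (level n) \<le> n"
proof (cases "level n")
  case (Suc m)
  then have "\<not> n < block_start (Suc m)"
    unfolding level_def by (metis lessI not_less_Least)
  with Suc show ?thesis by simp
qed (simp add: block_start_def)

lemma level_eqI:
  assumes "block_start m \<le> n" "n < block_start (Suc m)"
  shows "level n = m"
proof (rule antisym)
  show "level n \<le> m" unfolding level_def by (rule Least_le) fact
  show "m \<le> level n"
  proof (rule ccontr)
    assume "\<not> m \<le> level n"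
    then have "block_start (Suc (level n)) \<le> block_start m" by (intro block_start_mono) simp
    with level_less[of n] assms show False by simp
  qed
qed

lemma level_add [simp]: "d < 4 ^ m \<Longrightarrow> level (block_start m + d) = m"
  by (rule level_eqI) (auto simp: block_start_Suc)

lemma level_less_iff: "level n < M \<longleftrightarrow> n < block_start M"
  using level_ge[of n] level_less[of n] block_start_mono[of M "level n"]
    block_start_mono[of "Suc (level n)" M] by (cases "level n < M") auto

definition offset :: "nat \<Rightarrow> nat" where
  "offset n = n - block_start (level n)"

lemma offset_add [simp]: "d < 4 ^ m \<Longrightarrow> offset (block_start m + d) = d"
  by (simp add: offset_def)

lemma offset_less: "offset n < 4 ^ level n"
  using level_ge[of n] level_less[of n] by (simp add: offset_def block_start_Suc)

lemma block_start_add_offset: "block_start (level n) + offset n = n"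
  using level_ge[of n] by (simp add: offset_def)

lemma index_eqI: "level n = level n' \<Longrightarrow> offset n = offset n' \<Longrightarrow> n = n'"
  by (metis block_start_add_offset)

lemma sum_blocks:
  fixes f :: "nat \<Rightarrow> real"
  shows "(\<Sum>n<block_start M. f n) = (\<Sum>m<M. \<Sum>d<4 ^ m. f (block_start m + d))"
proof (induction M)
  case (Suc M)
  have "(\<Sum>n<block_start M + N. f n) = (\<Sum>n<block_start M. f n) + (\<Sum>d<N. f (block_start M + d))" for N
    by (induction N) auto
  with Suc show ?case by (simp add: block_start_Suc)
qed (simp add: block_start_def)

text \<open>Features are mixed only when their offsets in the block agree modulo \<open>2 ^ m\<close>, so that the
  mixed features have well-separated peaks.\<close>

definition block_mixer :: "nat \<Rightarrow> nat \<Rightarrow> nat \<Rightarrow> real" where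
  "block_mixer m d d' =
     (if d mod 2 ^ m = d' mod 2 ^ m then walsh m (d div 2 ^ m) (d' div 2 ^ m) / sqrt (2 ^ m) else 0)"

text \<open>Offsets are written in base \<open>2 ^ m\<close>: \<open>r\<close> is the residue class
  and \<open>s\<close> the position within it.\<close>

lemma sum_block:
  fixes f :: "nat \<Rightarrow> real"
  shows "(\<Sum>d<4 ^ m. f d) = (\<Sum>s<2 ^ m. \<Sum>r<2 ^ m. f (r + s * 2 ^ m))"
proof -
  have "(4::nat) ^ m = 2 ^ m * 2 ^ m" by (simp flip: power_mult_distrib)
  then have "(\<Sum>d<4 ^ m. f d) = (\<Sum>s<2 ^ m. sum f {s * 2 ^ m..<s * 2 ^ m + 2 ^ m})"
    by (simp add: sum.nat_group)
  also have "\<dots> = (\<Sum>s<2 ^ m. \<Sum>r<2 ^ m. f (r + s * 2 ^ m))"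
  proof (rule sum.cong[OF refl])
    fix s :: nat
    show "sum f {s * 2 ^ m..<s * 2 ^ m + 2 ^ m} = (\<Sum>r<2 ^ m. f (r + s * 2 ^ m))"
      using sum.shift_bounds_nat_ivl[of f 0 "s * 2 ^ m" "2 ^ m"]
      by (simp add: add.commute atLeast0LessThan)
  qed
  finally show ?thesis .
qed

lemma sum_block_residue:
  fixes f :: "nat \<Rightarrow> real"
  assumes "\<And>d'. d' mod 2 ^ m \<noteq> d mod 2 ^ m \<Longrightarrow> f d' = 0"
  shows "(\<Sum>d'<4 ^ m. f d') = (\<Sum>s<2 ^ m. f (d mod 2 ^ m + s * 2 ^ m))"
proof -
  have "(\<Sum>r<2 ^ m. f (r + s * 2 ^ m)) = f (d mod 2 ^ m + s * 2 ^ m)" for s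
  proof -
    have "(\<Sum>r<2 ^ m. f (r + s * 2 ^ m))
        = (\<Sum>r<2 ^ m. if r = d mod 2 ^ m then f (d mod 2 ^ m + s * 2 ^ m) else 0)"
      by (intro sum.cong refl) (auto intro!: assms)
    then show ?thesis by simp
  qed
  then show ?thesis unfolding sum_block by simp
qed

text \<open>Rows of different residue classes have disjoint supports. Within a class the claim is
  the orthogonality of Walsh rows, normalised by the two factors
  \<open>sqrt (2 ^ m)\<close>.\<close>

lemma block_mixer_orthogonal:
  assumes "d < 4 ^ m" "d' < 4 ^ m"
  shows "(\<Sum>e<4 ^ m. block_mixer m d e * block_mixer m d' e) = (if d = d' then 1 else 0)"
proof (cases "d mod 2 ^ m = d' mod 2 ^ m")
  case True
  have "(4::nat) ^ m = 2 ^ m * 2 ^ m" by (simp flip: power_mult_distrib)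
  then have *: "d div 2 ^ m < 2 ^ m" "d' div 2 ^ m < 2 ^ m"
    using assms by (auto simp: less_mult_imp_div_less)
  have "d = d' \<longleftrightarrow> d div 2 ^ m = d' div 2 ^ m"
    using True by (metis div_mult_mod_eq)
  have "(\<Sum>e<4 ^ m. block_mixer m d e * block_mixer m d' e)
      = (\<Sum>s<2 ^ m. block_mixer m d (d mod 2 ^ m + s * 2 ^ m) * block_mixer m d' (d mod 2 ^ m + s * 2 ^ m))"
    by (rule sum_block_residue) (auto simp: block_mixer_def)
  also have "\<dots> = (\<Sum>s<2 ^ m. walsh m (d div 2 ^ m) s * walsh m (d' div 2 ^ m) s) / 2 ^ m"
    using True by (simp add: block_mixer_def sum_divide_distrib)
  also have "\<dots> = (if d = d' then 1 else 0)"
    unfolding walsh_orthogonal[OF *] \<open>d = d' \<longleftrightarrow> _\<close> by simp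
  finally show ?thesis .
next
  case False
  then show ?thesis by (auto simp: block_mixer_def intro!: sum.neutral)
qed

text \<open>An infinite block-diagonal matrix; cut off at a block boundary, it is a finite symmetric
  orthogonal matrix.\<close>

definition mixer :: "nat \<Rightarrow> nat \<Rightarrow> real" where
  "mixer n k = (if level n = level k then block_mixer (level n) (offset n) (offset k) else 0)"

lemma mixer_sym: "mixer n k = mixer k n"
  by (auto simp: mixer_def block_mixer_def walsh_sym)

lemma mixer_row:
  assumes "n < block_start M"
  shows "(\<Sum>k<block_start M. mixer n k * f k)
    = (\<Sum>d<4 ^ level n. block_mixer (level n) (offset n) d * f (block_start (level n) + d))"
proof -
  have "(\<Sum>k<block_start M. mixer n k * f k)
      = (\<Sum>m<M. if m = level n then
          (\<Sum>d<4 ^ level n. block_mixer (level n) (offset n) d * f (block_start (level n) + d)) else 0)"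
    unfolding sum_blocks by (intro sum.cong refl) (auto simp: mixer_def)
  also have "\<dots> = (\<Sum>d<4 ^ level n. block_mixer (level n) (offset n) d * f (block_start (level n) + d))"
    using assms by (simp add: level_less_iff)
  finally show ?thesis .
qed

lemma mixer_orthogonal:
  assumes "n < block_start M" "n' < block_start M"
  shows "(\<Sum>k<block_start M. mixer n k * mixer n' k) = (if n = n' then 1 else 0)"
proof (cases "level n = level n'")
  case True
  have "n = n' \<longleftrightarrow> offset n = offset n'" using True index_eqI by auto
  have "(\<Sum>k<block_start M. mixer n k * mixer n' k)
      = (\<Sum>d<4 ^ level n. block_mixer (level n) (offset n) d * block_mixer (level n) (offset n') d)"
    unfolding mixer_row[OF assms(1)] using True by (intro sum.cong refl) (simp add: mixer_def)
  also have "\<dots> = (if n = n' then 1 else 0)"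
    unfolding \<open>n = n' \<longleftrightarrow> _\<close> using offset_less[of n] offset_less[of n'] True
    by (intro block_mixer_orthogonal) auto
  finally show ?thesis .
next
  case False
  then show ?thesis by (auto simp: mixer_def intro!: sum.neutral)
qed

text \<open>The sum stops at the end of the block of \<open>n\<close>; by \<open>mix_eq\<close> any
  later block boundary gives the same value.\<close>

definition mix :: "(nat \<Rightarrow> real \<Rightarrow> real) \<Rightarrow> nat \<Rightarrow> real \<Rightarrow> real" where
  "mix e n x = (\<Sum>k<block_start (Suc (level n)). mixer n k * e k x)"

lemma mix_eq:
  assumes "n < block_start M"
  shows "mix e n x = (\<Sum>k<block_start M. mixer n k * e k x)"
  unfolding mix_def mixer_row[OF level_less] mixer_row[OF assms] ..

text \<open>An orthogonal matrix preserves inner products. The columns have to be orthonormal here,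
  which follows from the rows because \<open>mixer\<close> is symmetric.\<close>

lemma sum_mix_mult:
  "(\<Sum>n<block_start M. mix e n x * mix e n y) = (\<Sum>k<block_start M. e k x * e k y)"
proof -
  let ?B = "{..<block_start M}"
  have "(\<Sum>n\<in>?B. mix e n x * mix e n y)
      = (\<Sum>n\<in>?B. \<Sum>k\<in>?B. \<Sum>l\<in>?B. (mixer k n * mixer l n) * (e k x * e l y))"
    by (intro sum.cong refl) (simp add: mix_eq sum_product mixer_sym mult_ac)
  also have "\<dots> = (\<Sum>k\<in>?B. \<Sum>n\<in>?B. \<Sum>l\<in>?B. (mixer k n * mixer l n) * (e k x * e l y))"
    by (rule sum.swap)
  also have "\<dots> = (\<Sum>k\<in>?B. \<Sum>l\<in>?B. \<Sum>n\<in>?B. (mixer k n * mixer l n) * (e k x * e l y))"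
    by (intro sum.cong refl sum.swap)
  also have "\<dots> = (\<Sum>k\<in>?B. \<Sum>l\<in>?B. (if k = l then 1 else 0) * (e k x * e l y))"
    by (intro sum.cong refl) (simp add: mixer_orthogonal flip: sum_distrib_right)
  also have "\<dots> = (\<Sum>k\<in>?B. \<Sum>l\<in>?B. if k = l then e k x * e l y else 0)"
    by (intro sum.cong refl) simp
  also have "\<dots> = (\<Sum>k\<in>?B. e k x * e k y)"
    by simp
  finally show ?thesis .
qed

lemma block_start_at_top: "filterlim block_start at_top sequentially"
  by (rule filterlim_at_top_mono[OF filterlim_ident]) (simp add: block_start_ge)

text \<open>The partial sums are known to agree only at block boundaries. Convergence is therefore
  shown first, from the bounded diagonal sums, and the limit is then identified along the
  boundaries.\<close>

lemma mix_sums: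
  assumes "\<And>x y. (\<lambda>k. e k x * e k y) sums K x y"
  shows "(\<lambda>n. mix e n x * mix e n y) sums K x y"
proof -
  have sq: "summable (\<lambda>n. mix e n x * mix e n x)" for x
  proof (rule summableI_nonneg_bounded)
    fix N
    have "(\<Sum>n<N. mix e n x * mix e n x) \<le> (\<Sum>n<block_start N. mix e n x * mix e n x)"
      using block_start_ge[of N] by (intro sum_mono2) auto
    also have "\<dots> = (\<Sum>k<block_start N. e k x * e k x)"
      by (rule sum_mix_mult)
    also have "\<dots> \<le> K x x"
      using assms[of x x] by (intro sum_le_sums) auto
    finally show "(\<Sum>n<N. mix e n x * mix e n x) \<le> K x x" .
  qed auto
  have "summable (\<lambda>n. mix e n x * mix e n y)"
  proof (rule summable_comparison_test')
    show "summable (\<lambda>n. mix e n x * mix e n x + mix e n y * mix e n y)"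
      by (intro summable_add sq)
    show "norm (mix e n x * mix e n y) \<le> mix e n x * mix e n x + mix e n y * mix e n y" for n
    proof -
      have "\<bar>a * b\<bar> \<le> a * a + b * b" for a b :: real
      proof -
        have "2 * (\<bar>a\<bar> * \<bar>b\<bar>) \<le> a * a + b * b"
          using sum_squares_bound[of "\<bar>a\<bar>" "\<bar>b\<bar>"] by (simp add: power2_eq_square)
        moreover have "0 \<le> \<bar>a\<bar> * \<bar>b\<bar>" by simp
        ultimately show ?thesis unfolding abs_mult by linarith
      qed
      then show ?thesis by simp
    qed
  qed
  then obtain S where S: "(\<lambda>n. mix e n x * mix e n y) sums S"
    by (auto simp: summable_def)
  have "(\<lambda>M. \<Sum>n<block_start M. mix e n x * mix e n y) \<longlonglongrightarrow> S"
    using filterlim_compose[OF S[unfolded sums_def] block_start_at_top] .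
  moreover have "(\<lambda>M. \<Sum>k<block_start M. e k x * e k y) \<longlonglongrightarrow> K x y"
    using filterlim_compose[OF assms[unfolded sums_def] block_start_at_top] .
  ultimately have "S = K x y"
    unfolding sum_mix_mult by (rule LIMSEQ_unique)
  with S show ?thesis by simp
qed

text \<open>A relation \<open>c\<close> among the mixed features is a relation among the original
  ones, with coefficients \<open>C\<close> obtained from \<open>c\<close> by the transposed matrix.
  This transformation is invertible.\<close>

lemma mix_independent:
  assumes "linearly_independent_family_on I e"
  shows "linearly_independent_family_on I (mix e)"
  unfolding linearly_independent_family_on_def
proof (intro allI impI)
  fix S and c :: "nat \<Rightarrow> real"
  assume S: "finite S" and eq0: "\<forall>x\<in>I. (\<Sum>n\<in>S. c n * mix e n x) = 0"
  obtain M where M: "S \<subseteq> {..<M}" using S finite_nat_bounded by blast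
  define B where "B = {..<block_start M}"
  have SB: "S \<subseteq> B" using M block_start_ge[of M] by (auto simp: B_def)
  have [simp]: "finite B" by (simp add: B_def)
  define C where "C k = (\<Sum>n\<in>S. c n * mixer n k)" for k
  have "(\<Sum>k\<in>B. C k * e k x) = 0" if "x \<in> I" for x
  proof -
    have "(\<Sum>k\<in>B. C k * e k x) = (\<Sum>k\<in>B. \<Sum>n\<in>S. c n * (mixer n k * e k x))"
      unfolding C_def sum_distrib_right by (simp add: mult.assoc)
    also have "\<dots> = (\<Sum>n\<in>S. \<Sum>k\<in>B. c n * (mixer n k * e k x))"
      by (rule sum.swap)
    also have "\<dots> = (\<Sum>n\<in>S. c n * mix e n x)"
      using SB by (intro sum.cong refl) (auto simp: mix_eq[of _ M] B_def sum_distrib_left)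
    finally show ?thesis using eq0 that by simp
  qed
  then have C0: "C k = 0" if "k \<in> B" for k
    using assms that \<open>finite B\<close> unfolding linearly_independent_family_on_def by blast
  show "\<forall>n\<in>S. c n = 0"
  proof
    fix n assume "n \<in> S"
    \<comment> \<open>Pairing \<open>C\<close> with row \<open>n\<close> recovers \<open>c n\<close>
      by orthonormality.\<close>
    have "0 = (\<Sum>k\<in>B. C k * mixer n k)" by (simp add: C0)
    also have "\<dots> = (\<Sum>k\<in>B. \<Sum>l\<in>S. c l * (mixer l k * mixer n k))"
      unfolding C_def sum_distrib_right by (simp add: mult.assoc)
    also have "\<dots> = (\<Sum>l\<in>S. \<Sum>k\<in>B. c l * (mixer l k * mixer n k))"
      by (rule sum.swap)
    also have "\<dots> = (\<Sum>l\<in>S. if l = n then c l else 0)"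
    proof (intro sum.cong refl)
      fix l assume "l \<in> S"
      then have "(\<Sum>k\<in>B. mixer l k * mixer n k) = (if l = n then 1 else 0)"
        using SB \<open>n \<in> S\<close> unfolding B_def by (intro mixer_orthogonal) auto
      then show "(\<Sum>k\<in>B. c l * (mixer l k * mixer n k)) = (if l = n then c l else 0)"
        by (simp flip: sum_distrib_left)
    qed
    also have "\<dots> = c n" using S \<open>n \<in> S\<close> by simp
    finally show "c n = 0" by simp
  qed
qed

text \<open>Row \<open>n\<close> is supported on one residue class of its block, and its
  \<open>2 ^ level n\<close> entries there all have modulus
  \<open>1 / sqrt (2 ^ level n)\<close>.\<close>

lemma abs_mix_le:
  "\<bar>mix e n x\<bar> \<le> (\<Sum>s<2 ^ level n.
     \<bar>e (block_start (level n) + (offset n mod 2 ^ level n + s * 2 ^ level n)) x\<bar>) / sqrt (2 ^ level n)"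
proof -
  define m where "m = level n"
  have "mix e n x = (\<Sum>s<2 ^ m. block_mixer m (offset n) (offset n mod 2 ^ m + s * 2 ^ m) *
      e (block_start m + (offset n mod 2 ^ m + s * 2 ^ m)) x)"
    unfolding mix_def mixer_row[OF level_less] m_def
    by (rule sum_block_residue) (simp add: block_mixer_def)
  then have "\<bar>mix e n x\<bar> \<le> (\<Sum>s<2 ^ m. \<bar>block_mixer m (offset n) (offset n mod 2 ^ m + s * 2 ^ m) *
      e (block_start m + (offset n mod 2 ^ m + s * 2 ^ m)) x\<bar>)"
    by (simp only: sum_abs)
  also have "\<dots> = (\<Sum>s<2 ^ m. \<bar>e (block_start m + (offset n mod 2 ^ m + s * 2 ^ m)) x\<bar> / sqrt (2 ^ m))"
    by (intro sum.cong refl) (simp add: block_mixer_def abs_mult abs_walsh)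
  finally show ?thesis by (simp add: m_def sum_divide_distrib)
qed

subsection \<open>Bounded intervals\<close>

lemma sup_norm_on_le:
  assumes "\<And>x. x \<in> I \<Longrightarrow> \<bar>f x\<bar> \<le> M"
  shows "sup_norm_on I f \<le> ereal M"
  unfolding sup_norm_on_def by (rule SUP_least) (simp add: assms)

lemma abs_le_sup_norm_on:
  assumes "sup_norm_on I f \<le> ereal M" "x \<in> I"
  shows "\<bar>f x\<bar> \<le> M"
proof -
  have "ereal \<bar>f x\<bar> \<le> sup_norm_on I f"
    unfolding sup_norm_on_def using assms(2) by (rule SUP_upper)
  with assms(1) show ?thesis by (metis ereal_less_eq(3) order_trans)
qed

text \<open>After cancelling the weight \<open>w\<close>, a relation is a polynomial with infinitely
  many roots.\<close>

lemma monomials_independent: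
  assumes "infinite I" "\<And>x. w x \<noteq> 0" "\<And>k. a k \<noteq> 0"
  shows "linearly_independent_family_on I (\<lambda>k x. a k * x ^ k * w x)"
  unfolding linearly_independent_family_on_def
proof (intro allI impI)
  fix S and c :: "nat \<Rightarrow> real"
  assume S: "finite S" and eq0: "\<forall>x\<in>I. (\<Sum>k\<in>S. c k * (a k * x ^ k * w x)) = 0"
  obtain n where n: "S \<subseteq> {..n}" using S finite_nat_iff_bounded_le by blast
  define b where "b k = (if k \<in> S then c k * a k else 0)" for k
  have "(\<Sum>i\<le>n. b i * x ^ i) = 0" if "x \<in> I" for x
  proof -
    have "(\<Sum>i\<le>n. b i * x ^ i) = (\<Sum>k\<in>S. c k * a k * x ^ k)"
      using n by (intro sum.mono_neutral_cong_right) (auto simp: b_def)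
    then have "(\<Sum>i\<le>n. b i * x ^ i) * w x = (\<Sum>k\<in>S. c k * (a k * x ^ k * w x))"
      by (simp only: sum_distrib_right mult.assoc)
    with eq0 that assms(2)[of x] show ?thesis by simp
  qed
  then have "I \<subseteq> {x. (\<Sum>i\<le>n. b i * x ^ i) = 0}" by blast
  with assms(1) have "\<not> finite {x. (\<Sum>i\<le>n. b i * x ^ i) = 0}" using finite_subset by blast
  then have "b k = 0" if "k \<le> n" for k
    using that Transcendental.polyfun_finite_roots[of b n] by blast
  with n assms(3) show "\<forall>k\<in>S. c k = 0" by (fastforce simp: b_def)
qed

lemma gaussian_kernel_sums:
  assumes "\<eta> > 0"
  shows "(\<lambda>k. (2 / \<eta>) ^ k / fact k * (x ^ k * exp (- (x\<^sup>2 / \<eta>))) * (y ^ k * exp (- (y\<^sup>2 / \<eta>))))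
    sums gaussian_kernel \<eta> x y"
proof -
  have "exp (2 / \<eta> * x * y) * (exp (- (x\<^sup>2 / \<eta>)) * exp (- (y\<^sup>2 / \<eta>))) = gaussian_kernel \<eta> x y"
    unfolding gaussian_kernel_def exp_add[symmetric] using assms
    by (simp add: power2_eq_square field_simps)
  moreover have "(\<lambda>k. (2 / \<eta> * x * y) ^ k /\<^sub>R fact k * (exp (- (x\<^sup>2 / \<eta>)) * exp (- (y\<^sup>2 / \<eta>))))
      sums (exp (2 / \<eta> * x * y) * (exp (- (x\<^sup>2 / \<eta>)) * exp (- (y\<^sup>2 / \<eta>))))"
    by (intro sums_mult2 exp_converges)
  ultimately show ?thesis by (simp add: power_mult_distrib field_simps)
qed

lemma gaussian_expansion_bounded:
  assumes "\<eta> > 0" "bounded I" "infinite I"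
  shows "admits_expansion_on 1 I (gaussian_kernel \<eta>)"
proof -
  obtain R where R: "R > 0" "\<And>x. x \<in> I \<Longrightarrow> \<bar>x\<bar> \<le> R"
    using assms(2) bounded_pos by (metis real_norm_def)
  \<comment> \<open>The power \<open>R ^ (2 * k)\<close> is moved from the features to the
    coefficients: the features become bounded by 1, and the factorial keeps the coefficients
    summable.\<close>
  define \<Lambda> where "\<Lambda> k = (2 * R\<^sup>2 / \<eta>) ^ k / fact k" for k
  define \<psi> where "\<psi> k x = (1 / R) ^ k * x ^ k * exp (- (x\<^sup>2 / \<eta>))" for k x
  have nonneg: "\<Lambda> k \<ge> 0" for k using assms(1) by (simp add: \<Lambda>_def)
  have "(\<lambda>k. \<Lambda> k * \<psi> k x * \<psi> k y) sums gaussian_kernel \<eta> x y" for x y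
  proof -
    have "\<Lambda> k * \<psi> k x * \<psi> k y =
        (2 / \<eta>) ^ k / fact k * (x ^ k * exp (- (x\<^sup>2 / \<eta>))) * (y ^ k * exp (- (y\<^sup>2 / \<eta>)))" for k
      using R(1) unfolding \<Lambda>_def \<psi>_def
      by (simp add: power_mult_distrib power_divide power2_eq_square)
    with gaussian_kernel_sums[OF assms(1)] show ?thesis by simp
  qed
  moreover have "summable (\<lambda>k. \<Lambda> k powr 1)"
    using summable_exp[of "2 * R\<^sup>2 / \<eta>"] nonneg
    by (simp add: \<Lambda>_def divide_inverse mult.commute)
  moreover have "linearly_independent_family_on I \<psi>"
    using monomials_independent[OF assms(3), of "\<lambda>x. exp (- (x\<^sup>2 / \<eta>))" "\<lambda>k. (1 / R) ^ k"] R(1)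
    by (simp add: \<psi>_def[abs_def])
  moreover have "sup_norm_on I (\<psi> k) \<le> ereal 1" for k
  proof (rule sup_norm_on_le)
    fix x assume "x \<in> I"
    then have "(\<bar>x\<bar> / R) ^ k * exp (- (x\<^sup>2 / \<eta>)) \<le> 1 * 1"
      using R assms(1) by (intro mult_mono power_le_one) auto
    then show "\<bar>\<psi> k x\<bar> \<le> 1"
      using R(1) by (simp add: \<psi>_def abs_mult power_abs power_divide)
  qed
  ultimately show ?thesis
    unfolding admits_expansion_on_def using nonneg by blast
qed

subsection \<open>Stationary kernels vanishing at infinity\<close>

text \<open>Pigeonhole: rounding the first \<open>N\<close> coordinates to a grid of mesh
  \<open>\<epsilon>\<close> leaves finitely many patterns for infinitely many
  \<open>i\<close>.\<close>

lemma simultaneous_recurrence: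
  fixes u :: "nat \<Rightarrow> nat \<Rightarrow> real"
  assumes "\<And>i k. \<bar>u i k\<bar> \<le> M" "\<epsilon> > 0"
  obtains i j where "i < j" "\<And>k. k < N \<Longrightarrow> \<bar>u i k - u j k\<bar> \<le> \<epsilon>"
proof -
  define g where "g i = (\<lambda>k\<in>{..<N}. \<lfloor>u i k / \<epsilon>\<rfloor>)" for i
  have "range g \<subseteq> {..<N} \<rightarrow>\<^sub>E {\<lfloor>- M / \<epsilon>\<rfloor>..\<lfloor>M / \<epsilon>\<rfloor>}"
  proof -
    have "- M / \<epsilon> \<le> u i k / \<epsilon>" "u i k / \<epsilon> \<le> M / \<epsilon>" for i k
      using assms(1)[of i k] assms(2) by (auto simp: divide_simps)
    then show ?thesis unfolding g_def by (intro image_subsetI restrict_PiE) (auto intro!: floor_mono)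
  qed
  then have "finite (range g)"
    by (rule finite_subset) (intro finite_PiE; simp)
  then have "\<not> inj g" using finite_imageD infinite_UNIV_nat by blast
  then obtain i j where ij: "g i = g j" "i < j"
    by (metis injI linorder_neqE_nat)
  have "\<bar>u i k - u j k\<bar> \<le> \<epsilon>" if "k < N" for k
  proof -
    have "\<lfloor>u i k / \<epsilon>\<rfloor> = \<lfloor>u j k / \<epsilon>\<rfloor>"
      using fun_cong[OF ij(1), of k] that by (simp add: g_def)
    then have "\<bar>u i k / \<epsilon> - u j k / \<epsilon>\<bar> \<le> 1" by linarith
    then have "\<bar>(u i k - u j k) / \<epsilon>\<bar> \<le> 1" by (simp add: diff_divide_distrib)
    then show ?thesis using assms(2) by (simp add: divide_simps)
  qed
  with ij(2) that show thesis by blast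
qed

lemma vanishing_kernel_no_expansion:
  fixes F :: "real \<Rightarrow> real"
  assumes "(F \<longlongrightarrow> 0) at_top" "F \<bar>x0 - y0\<bar> \<noteq> 0"
  shows "\<not> admits_expansion_on 1 UNIV (\<lambda>x y. F \<bar>x - y\<bar>)"
proof
  assume "admits_expansion_on 1 UNIV (\<lambda>x y. F \<bar>x - y\<bar>)"
  then obtain \<Lambda> \<psi> M where nonneg: "\<And>k. \<Lambda> k \<ge> 0"
    and sums: "\<And>x y. (\<lambda>k. \<Lambda> k * \<psi> k x * \<psi> k y) sums F \<bar>x - y\<bar>"
    and "summable (\<lambda>k. \<Lambda> k powr 1)" and sup: "\<And>k. sup_norm_on UNIV (\<psi> k) \<le> ereal M"
    unfolding admits_expansion_on_def by blast
  then have summ: "summable \<Lambda>" by simp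
  have bound: "\<bar>\<psi> k x\<bar> \<le> M" for k x using abs_le_sup_norm_on[OF sup] by simp
  \<comment> \<open>The squared distance between the feature vectors of \<open>x\<close> and
    \<open>y\<close>.\<close>
  have diff_sums: "(\<lambda>k. \<Lambda> k * (\<psi> k x - \<psi> k y)\<^sup>2) sums (2 * (F 0 - F \<bar>x - y\<bar>))" for x y
  proof -
    have "(\<lambda>k. \<Lambda> k * \<psi> k x * \<psi> k x + \<Lambda> k * \<psi> k y * \<psi> k y - 2 * (\<Lambda> k * \<psi> k x * \<psi> k y))
        sums (F \<bar>x - x\<bar> + F \<bar>y - y\<bar> - 2 * F \<bar>x - y\<bar>)"
      by (intro sums_add sums_diff sums_mult sums)
    moreover have "\<Lambda> k * \<psi> k x * \<psi> k x + \<Lambda> k * \<psi> k y * \<psi> k y - 2 * (\<Lambda> k * \<psi> k x * \<psi> k y)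
        = \<Lambda> k * (\<psi> k x - \<psi> k y)\<^sup>2" for k
      by (simp add: power2_eq_square algebra_simps)
    ultimately show ?thesis by simp
  qed
  \<comment> \<open>If \<open>F 0\<close> were 0, every term of the diagonal series would vanish,
    and with it the whole kernel.\<close>
  have "F 0 > 0"
  proof (rule ccontr)
    have "F 0 \<ge> 0"
      using sum_le_sums[OF sums[of 0 0], of "{}"] nonneg by (simp add: mult.assoc)
    moreover assume "\<not> F 0 > 0"
    ultimately have zero: "(\<lambda>k. \<Lambda> k * (\<psi> k x * \<psi> k x)) sums 0" for x
      using sums[of x x] by (simp add: mult.assoc)
    have "\<Lambda> k * (\<psi> k x * \<psi> k x) = 0" for k x
      using suminf_eq_zero_iff[OF sums_summable[OF zero[of x]]] sums_unique[OF zero[of x]] nonneg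
      by simp
    then have "\<Lambda> k * \<psi> k x0 * \<psi> k y0 = 0" for k by (metis mult_eq_0_iff)
    then have "(\<lambda>k. 0) sums F \<bar>x0 - y0\<bar>" using sums[of x0 y0] by (simp only:)
    with assms(2) show False using sums_unique2 sums_zero by blast
  qed
  define a where "a = F 0"
  have "a > 0" using \<open>F 0 > 0\<close> by (simp add: a_def)
  have "eventually (\<lambda>r. F r < a / 2) at_top"
    using assms(1) \<open>a > 0\<close> by (intro order_tendstoD) auto
  then obtain D where D: "\<And>r. r \<ge> D \<Longrightarrow> F r < a / 2" by (auto simp: eventually_at_top_linorder)
  \<comment> \<open>The maximum makes the spacing positive, so distinct multiples of
    \<open>D'\<close> are at least \<open>D\<close> apart.\<close>
  define D' where "D' = max D 1"
  \<comment> \<open>Chosen so that the first \<open>N\<close> terms of the squared distance add up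
    to at most \<open>a / 4\<close>; adding 1 keeps the denominator positive.\<close>
  define \<epsilon> where "\<epsilon> = sqrt (a / (4 * (suminf \<Lambda> + 1)))"
  have "suminf \<Lambda> \<ge> 0" using summ nonneg by (simp add: suminf_nonneg)
  then have "\<epsilon> > 0" and \<epsilon>: "\<epsilon>\<^sup>2 * suminf \<Lambda> \<le> a / 4"
    using \<open>a > 0\<close> by (auto simp: \<epsilon>_def field_simps)
  have "(\<lambda>N. \<Sum>k. \<Lambda> (k + N)) \<longlonglongrightarrow> 0"
    using suminf_exist_split2[OF summ] .
  then have "(\<lambda>N. 4 * M\<^sup>2 * (\<Sum>k. \<Lambda> (k + N))) \<longlonglongrightarrow> 4 * M\<^sup>2 * 0"
    by (intro tendsto_intros)
  then have "eventually (\<lambda>N. 4 * M\<^sup>2 * (\<Sum>k. \<Lambda> (k + N)) < a / 4) sequentially"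
    using \<open>a > 0\<close> by (intro order_tendstoD) auto
  then obtain N where N: "4 * M\<^sup>2 * (\<Sum>k. \<Lambda> (k + N)) < a / 4"
    by (auto simp: eventually_sequentially)
  obtain i j where "i < j" and close: "\<And>k. k < N \<Longrightarrow> \<bar>\<psi> k (D' * real i) - \<psi> k (D' * real j)\<bar> \<le> \<epsilon>"
    using simultaneous_recurrence[of "\<lambda>i k. \<psi> k (D' * real i)" M \<epsilon> N] bound \<open>\<epsilon> > 0\<close> by blast
  define x y where "x = D' * real i" and "y = D' * real j"
  have "\<bar>x - y\<bar> = D' * (real j - real i)"
    using \<open>i < j\<close> by (simp add: x_def y_def D'_def abs_mult flip: right_diff_distrib)
  also have "\<dots> \<ge> D' * 1" using \<open>i < j\<close> by (intro mult_left_mono) (auto simp: D'_def)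
  finally have "F \<bar>x - y\<bar> < a / 2" by (intro D) (simp add: D'_def)
  \<comment> \<open>Head and tail together stay below \<open>a / 2\<close>, whereas
    \<open>F \<bar>x - y\<bar> < a / 2\<close> forces the sum of \<open>t\<close> above
    \<open>a\<close>.\<close>
  define t where "t k = \<Lambda> k * (\<psi> k x - \<psi> k y)\<^sup>2" for k
  have t: "t sums (2 * (F 0 - F \<bar>x - y\<bar>))" unfolding t_def by (rule diff_sums)
  have "(\<Sum>k<N. t k) \<le> (\<Sum>k<N. \<epsilon>\<^sup>2 * \<Lambda> k)"
  proof (rule sum_mono)
    fix k assume "k \<in> {..<N}"
    then have "(\<psi> k x - \<psi> k y)\<^sup>2 \<le> \<epsilon>\<^sup>2"
      using close[of k] \<open>\<epsilon> > 0\<close> by (simp add: abs_le_square_iff[symmetric] x_def y_def)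
    then show "t k \<le> \<epsilon>\<^sup>2 * \<Lambda> k"
      using mult_right_mono[OF _ nonneg] by (simp add: t_def mult.commute[of "\<Lambda> k"])
  qed
  also have "\<dots> \<le> \<epsilon>\<^sup>2 * suminf \<Lambda>"
    using sum_le_suminf[OF summ, of "{..<N}"] nonneg by (simp add: mult_left_mono flip: sum_distrib_left)
  finally have head: "(\<Sum>k<N. t k) \<le> a / 4" using \<epsilon> by simp
  have summN: "summable (\<lambda>k. \<Lambda> (k + N))" using summ by (rule summable_ignore_initial_segment)
  have "(\<Sum>k. t (k + N)) \<le> (\<Sum>k. 4 * M\<^sup>2 * \<Lambda> (k + N))"
  proof (rule suminf_le)
    show "t (k + N) \<le> 4 * M\<^sup>2 * \<Lambda> (k + N)" for k
    proof -
      have "\<bar>\<psi> (k + N) x - \<psi> (k + N) y\<bar> \<le> 2 * M"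
        using bound[of "k + N" x] bound[of "k + N" y] by linarith
      then have "(\<psi> (k + N) x - \<psi> (k + N) y)\<^sup>2 \<le> (2 * M)\<^sup>2"
        by (intro iffD1[OF abs_le_square_iff]) simp
      then have "t (k + N) \<le> \<Lambda> (k + N) * (2 * M)\<^sup>2"
        unfolding t_def by (rule mult_left_mono) (rule nonneg)
      then show ?thesis by (simp add: power_mult_distrib mult_ac)
    qed
    show "summable (\<lambda>k. t (k + N))"
      using t by (intro summable_ignore_initial_segment) (rule sums_summable)
    show "summable (\<lambda>k. 4 * M\<^sup>2 * \<Lambda> (k + N))" using summN by (rule summable_mult)
  qed
  also have "\<dots> = 4 * M\<^sup>2 * (\<Sum>k. \<Lambda> (k + N))" using suminf_mult[OF summN] .
  finally have "(\<Sum>k. t (k + N)) < a / 4" using N by simp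
  moreover have "suminf t = (\<Sum>k. t (k + N)) + (\<Sum>k<N. t k)"
    using t by (intro suminf_split_initial_segment) (rule sums_summable)
  ultimately have "2 * (F 0 - F \<bar>x - y\<bar>) < a / 2"
    using head sums_unique[OF t] by simp
  with \<open>F \<bar>x - y\<bar> < a / 2\<close> \<open>a > 0\<close> show False by (simp add: a_def)
qed

subsection \<open>The Gaussian kernel on the line\<close>

text \<open>Let \<open>f s0\<close> be the point nearest to \<open>y\<close>. Every other
  \<open>f s\<close> is at distance at least \<open>\<delta> * \<bar>s - s0\<bar> / 2\<close> from
  \<open>y\<close>, so the sum is dominated by two geometric series of ratio
  \<open>exp (- \<delta>\<^sup>2 / 8)\<close>.\<close>

lemma exp_half_squares_separated:
  fixes f :: "nat \<Rightarrow> real"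
  assumes "\<delta> > 0" "\<And>s s'. s < s' \<Longrightarrow> s' < n \<Longrightarrow> f s' - f s \<ge> \<delta> * real (s' - s)"
  shows "(\<Sum>s<n. exp (- (y - f s)\<^sup>2 / 2)) \<le> 2 / (1 - exp (- \<delta>\<^sup>2 / 8))"
proof -
  define \<rho> where "\<rho> = exp (- \<delta>\<^sup>2 / 8)"
  have \<rho>: "0 < \<rho>" "\<rho> < 1" using assms(1) by (auto simp: \<rho>_def)
  show ?thesis
  proof (cases "n = 0")
    case False
    then obtain s0 where s0: "s0 < n" "\<And>s. s < n \<Longrightarrow> \<bar>y - f s0\<bar> \<le> \<bar>y - f s\<bar>"
      using ex_is_arg_min_if_finite[of "{..<n}" "\<lambda>s. \<bar>y - f s\<bar>"]
      by (force simp: is_arg_min_linorder)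
    have dist: "\<bar>f s - f s0\<bar> \<ge> \<delta> * \<bar>real s - real s0\<bar>" if "s < n" for s
      using that s0(1) assms(2)[of s s0] assms(2)[of s0 s]
      by (cases s s0 rule: linorder_cases) (auto simp: of_nat_diff)
    \<comment> \<open>With truncated subtraction one of the two exponents is 0 and the other is the
      distance of \<open>s\<close> and \<open>s0\<close>.\<close>
    have term_le: "exp (- (y - f s)\<^sup>2 / 2) \<le> \<rho> ^ (s - s0) * \<rho> ^ (s0 - s)" if "s < n" for s
    proof -
      define d where "d = (s - s0) + (s0 - s)"
      have d: "real d = \<bar>real s - real s0\<bar>" by (auto simp: d_def)
      have "\<bar>f s - f s0\<bar> \<le> 2 * \<bar>y - f s\<bar>"
        using s0(2)[OF that] abs_triangle_ineq4[of "y - f s0" "y - f s"] by simp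
      with dist[OF that] have "\<delta> * real d \<le> 2 * \<bar>y - f s\<bar>" unfolding d by (rule order.trans)
      then have "(\<delta> * real d)\<^sup>2 \<le> (2 * \<bar>y - f s\<bar>)\<^sup>2"
        using assms(1) by (intro power_mono) auto
      moreover have "real d \<le> (real d)\<^sup>2" by (cases d) (auto simp: power2_eq_square)
      then have "\<delta>\<^sup>2 * real d \<le> (\<delta> * real d)\<^sup>2"
        by (simp add: power_mult_distrib mult_left_mono)
      ultimately have "\<delta>\<^sup>2 * real d \<le> (2 * \<bar>y - f s\<bar>)\<^sup>2" by linarith
      then have "- (y - f s)\<^sup>2 / 2 \<le> real d * (- \<delta>\<^sup>2 / 8)" by (simp add: power_mult_distrib mult.commute)
      then have "exp (- (y - f s)\<^sup>2 / 2) \<le> \<rho> ^ d"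
        unfolding \<rho>_def exp_of_nat_mult[symmetric] by simp
      then show ?thesis by (simp add: d_def power_add)
    qed
    have geom: "(\<Sum>i<m. \<rho> ^ i) \<le> 1 / (1 - \<rho>)" for m
      using \<rho> by (subst sum_gp_strict) (auto intro!: divide_right_mono)
    have "(\<Sum>s<n. exp (- (y - f s)\<^sup>2 / 2)) \<le> (\<Sum>s<n. \<rho> ^ (s - s0) * \<rho> ^ (s0 - s))"
      by (intro sum_mono term_le) simp
    \<comment> \<open>The range is enlarged so that it splits at \<open>s0\<close> into two plain
      power sums.\<close>
    also have "\<dots> \<le> (\<Sum>s<s0 + n. \<rho> ^ (s - s0) * \<rho> ^ (s0 - s))"
      using \<rho> by (intro sum_mono2) auto
    also have "\<dots> = (\<Sum>s<s0. \<rho> ^ (s0 - s)) + (\<Sum>i<n. \<rho> ^ i)"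
    proof -
      have "(\<Sum>s<s0 + m. \<rho> ^ (s - s0) * \<rho> ^ (s0 - s)) = (\<Sum>s<s0. \<rho> ^ (s0 - s)) + (\<Sum>i<m. \<rho> ^ i)" for m
        by (induction m) auto
      then show ?thesis .
    qed
    also have "(\<Sum>s<s0. \<rho> ^ (s0 - s)) \<le> (\<Sum>i<Suc s0. \<rho> ^ i)"
    proof -
      have "(\<Sum>s<s0. \<rho> ^ (s0 - s)) = (\<Sum>i<s0. \<rho> ^ Suc i)"
        using sum.nat_diff_reindex[of "\<lambda>i. \<rho> ^ Suc i" s0]
        by (auto intro!: sum.cong simp flip: power_Suc simp: Suc_diff_Suc)
      then show ?thesis using \<rho> by (subst sum.lessThan_Suc_shift) auto
    qed
    finally show ?thesis using geom[of n] geom[of "Suc s0"] by (simp add: \<rho>_def)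
  qed (use \<rho> in \<open>simp add: \<rho>_def\<close>)
qed

text \<open>With \<open>w = sqrt (t / k)\<close> this is \<open>w \<le> exp (w - 1)\<close> raised
  to the power \<open>2 * k\<close>; the exponents then combine into a complete square.\<close>

lemma poisson_term_le_peak:
  fixes t :: real
  assumes "t \<ge> 0"
  shows "t ^ k * exp (- t) \<le> real k ^ k * exp (- real k) * exp (- (sqrt t - sqrt (real k))\<^sup>2)"
proof (cases "k = 0")
  case False
  define w where "w = sqrt (t / real k)"
  have "w \<ge> 0" "t = w\<^sup>2 * real k" using False assms by (auto simp: w_def)
  then have sqrt_t: "sqrt t = w * sqrt (real k)" by (simp add: real_sqrt_mult)
  have "w \<le> exp (w - 1)" using exp_ge_add_one_self[of "w - 1"] by simp
  then have "w ^ (2 * k) \<le> exp (w - 1) ^ (2 * k)" using \<open>w \<ge> 0\<close> by (rule power_mono)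
  also have "\<dots> = exp (real (2 * k) * (w - 1))" by (rule exp_of_nat_mult[symmetric])
  finally have "t ^ k * exp (- t) \<le> real k ^ k * exp (real (2 * k) * (w - 1)) * exp (- t)"
    unfolding \<open>t = w\<^sup>2 * real k\<close> by (simp add: power_mult_distrib mult_ac mult_left_mono flip: power_mult)
  also have "\<dots> = real k ^ k * exp (- real k) * exp (- (sqrt t - sqrt (real k))\<^sup>2)"
  proof -
    have "real (2 * k) * (w - 1) + - t = - real k + - (sqrt t - sqrt (real k))\<^sup>2"
      unfolding sqrt_t unfolding \<open>t = w\<^sup>2 * real k\<close>
      by (simp add: power2_eq_square algebra_simps)
    then show ?thesis by (simp add: mult.assoc flip: exp_add)
  qed
  finally show ?thesis .
qed (use assms in simp)

text \<open>The probabilities \<open>P(k), \<dots>, P(k + L - 1)\<close> of the Poisson distribution with mean \<open>k\<close> are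
  comparable, and their sum is at most \<open>1\<close>.\<close>

lemma poisson_peak_le:
  assumes "L > 0" "(L - 1)\<^sup>2 \<le> 4 * k"
  shows "real k ^ k * exp (- real k) / fact k \<le> exp 4 / real L"
proof -
  define P where "P = real k ^ k * exp (- real k) / fact k"
  have "exp (- 4) * P \<le> real k ^ (k + i) / fact (k + i) * exp (- real k)" if "i < L" for i
  proof (cases "k = 0")
    \<comment> \<open>Here the hypothesis on \<open>L\<close> forces \<open>L = 1\<close>, leaving
      only the index 0.\<close>
    case True
    with assms that have "i = 0" by (cases L) auto
    with True show ?thesis by (simp add: P_def)
  next
    case False
    have "i\<^sup>2 \<le> (L - 1)\<^sup>2" using that by (intro power_mono) auto
    then have "i\<^sup>2 \<le> 4 * k" using assms(2) by (rule order.trans)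
    then have "real (i\<^sup>2) \<le> real (4 * k)" by (rule of_nat_mono)
    then have "(real i)\<^sup>2 \<le> 4 * real k" by simp
    then have i4: "real i * (real i / real k) \<le> 4" using False by (simp add: field_simps power2_eq_square)
    have "fact (k + i) \<le> (fact k * (k + i) ^ i :: nat)"
    proof -
      have "fact (k + i) div fact (k + i - i) \<le> (k + i) ^ i" by (rule fact_div_fact_le_pow) simp
      then have "fact (k + i) div fact k * fact k \<le> (k + i) ^ i * (fact k :: nat)"
        by (intro mult_right_mono) auto
      then show ?thesis by (simp add: fact_dvd mult.commute)
    qed
    then have "real (fact (k + i)) \<le> real (fact k * (k + i) ^ i)" by (rule of_nat_mono)
    then have "fact (k + i) \<le> fact k * (real k + real i) ^ i" by simp
    \<comment> \<open>From \<open>1 + i / k \<le> exp (i / k)\<close>. The total loss is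
      \<open>exp (i\<^sup>2 / k)\<close>, at most \<open>exp 4\<close> because
      \<open>i \<le> L - 1\<close>.\<close>
    also have "(real k + real i) ^ i \<le> (real k * exp (real i / real k)) ^ i"
    proof (rule power_mono)
      show "real k + real i \<le> real k * exp (real i / real k)"
        using mult_left_mono[OF exp_ge_add_one_self[of "real i / real k"], of "real k"] False
        by (simp add: distrib_left)
    qed simp
    also have "\<dots> = real k ^ i * exp (real i * (real i / real k))"
      by (simp add: power_mult_distrib flip: exp_of_nat_mult)
    also have "\<dots> \<le> real k ^ i * exp 4" using i4 by (intro mult_left_mono) auto
    finally have "fact (k + i) \<le> fact k * (real k ^ i * exp 4)" by simp
    then have "exp (- 4) / fact k \<le> real k ^ i / fact (k + i)"
      using False by (simp add: divide_simps exp_minus) (simp add: mult_ac)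
    then have "exp (- 4) / fact k * (real k ^ k * exp (- real k))
        \<le> real k ^ i / fact (k + i) * (real k ^ k * exp (- real k))"
      by (rule mult_right_mono) simp
    then show ?thesis by (simp add: P_def power_add mult_ac)
  qed
  then have "(\<Sum>i<L. exp (- 4) * P) \<le> (\<Sum>i<L. real k ^ (k + i) / fact (k + i) * exp (- real k))"
    by (intro sum_mono) simp
  also have "\<dots> = (\<Sum>j\<in>{k..<k + L}. real k ^ j / fact j * exp (- real k))"
    by (rule sum.reindex_bij_witness[of _ "\<lambda>j. j - k" "\<lambda>i. k + i"]) auto
  also have "\<dots> \<le> exp (real k) * exp (- real k)"
  proof (rule sum_le_sums)
    show "(\<lambda>j. real k ^ j / fact j * exp (- real k)) sums (exp (real k) * exp (- real k))"
      using exp_converges[of "real k"] by (intro sums_mult2) (simp add: divide_inverse mult.commute)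
  qed auto
  also have "\<dots> = 1" by (simp flip: exp_add)
  finally have "real L * (exp (- 4) * P) \<le> 1" by simp
  then show ?thesis using assms(1) unfolding P_def[symmetric]
    by (simp add: field_simps exp_minus)
qed

section \<open>Size and separation of the Gaussian features\<close>

definition gaussian_feature :: "real \<Rightarrow> nat \<Rightarrow> real \<Rightarrow> real" where
  "gaussian_feature \<eta> k x = sqrt ((2 / \<eta>) ^ k / fact k) * x ^ k * exp (- (x\<^sup>2 / \<eta>))"

lemma gaussian_feature_sums:
  assumes "\<eta> > 0"
  shows "(\<lambda>k. gaussian_feature \<eta> k x * gaussian_feature \<eta> k y) sums gaussian_kernel \<eta> x y"
proof -
  have *: "sqrt c * a * b * (sqrt c * a' * b') = c * (a * b) * (a' * b')" if "c \<ge> 0" for c a b a' b' :: real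
  proof -
    have "sqrt c * sqrt c = c" using that by simp
    then show ?thesis by (metis mult.assoc mult.commute)
  qed
  have "gaussian_feature \<eta> k x * gaussian_feature \<eta> k y =
      (2 / \<eta>) ^ k / fact k * (x ^ k * exp (- (x\<^sup>2 / \<eta>))) * (y ^ k * exp (- (y\<^sup>2 / \<eta>)))" for k
    unfolding gaussian_feature_def by (rule *) (use assms in simp)
  with gaussian_kernel_sums[OF assms] show ?thesis by simp
qed

text \<open>The squared feature is a Poisson probability with mean \<open>t\<close>, to which both
  Poisson bounds apply; the square root turns \<open>exp 4 / L\<close> into
  \<open>exp 2 / sqrt L\<close> and halves the Gaussian exponent.\<close>

lemma gaussian_feature_le:
  assumes "\<eta> > 0" "L > 0" "(L - 1)\<^sup>2 \<le> 4 * k"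
  shows "\<bar>gaussian_feature \<eta> k x\<bar>
    \<le> exp 2 / sqrt (real L) * exp (- (sqrt (2 * x\<^sup>2 / \<eta>) - sqrt (real k))\<^sup>2 / 2)"
proof (rule power2_le_imp_le)
  define t where "t = 2 * x\<^sup>2 / \<eta>"
  have "t \<ge> 0" using assms(1) by (simp add: t_def)
  have "\<bar>gaussian_feature \<eta> k x\<bar>\<^sup>2 = (2 / \<eta>) ^ k / fact k * (x ^ k)\<^sup>2 * (exp (- (x\<^sup>2 / \<eta>)))\<^sup>2"
    using assms(1) by (simp add: gaussian_feature_def power_mult_distrib)
  also have "(x ^ k)\<^sup>2 = (x\<^sup>2) ^ k" by (simp add: power_mult[symmetric] mult.commute)
  also have "(exp (- (x\<^sup>2 / \<eta>)))\<^sup>2 = exp (- t)"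
    by (simp add: t_def power2_eq_square flip: exp_add)
  also have "(2 / \<eta>) ^ k / fact k * (x\<^sup>2) ^ k * exp (- t) = t ^ k * exp (- t) / fact k"
    by (simp add: t_def power_mult_distrib power_divide)
  also have "\<dots> \<le> real k ^ k * exp (- real k) * exp (- (sqrt t - sqrt (real k))\<^sup>2) / fact k"
    using poisson_term_le_peak[OF \<open>t \<ge> 0\<close>] by (intro divide_right_mono) auto
  also have "\<dots> = real k ^ k * exp (- real k) / fact k * exp (- (sqrt t - sqrt (real k))\<^sup>2)"
    by simp
  also have "\<dots> \<le> exp 4 / real L * exp (- (sqrt t - sqrt (real k))\<^sup>2)"
    using poisson_peak_le[OF assms(2,3)] by (intro mult_right_mono) auto
  also have "\<dots> = (exp 2 / sqrt (real L) * exp (- (sqrt t - sqrt (real k))\<^sup>2 / 2))\<^sup>2"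
    by (simp add: power_mult_distrib power_divide flip: exp_double)
  finally show "\<bar>gaussian_feature \<eta> k x\<bar>\<^sup>2
    \<le> (exp 2 / sqrt (real L) * exp (- (sqrt (2 * x\<^sup>2 / \<eta>) - sqrt (real k))\<^sup>2 / 2))\<^sup>2"
    by (simp add: t_def)
qed simp

text \<open>Provides the hypothesis of \<open>gaussian_feature_le\<close>, with
  \<open>L = 2 ^ m\<close>, for every index of block \<open>m\<close>.\<close>

lemma block_start_lower: "(2 ^ m - 1)\<^sup>2 \<le> 4 * block_start m"
proof -
  have "4 ^ m = (2 ^ m * 2 ^ m :: nat)" by (simp flip: power_mult_distrib)
  moreover obtain l where "2 ^ m = Suc l" by (metis not0_implies_Suc power_not_zero zero_neq_numeral)
  ultimately show ?thesis using block_start_closed[of m] by (simp add: power2_eq_square)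
qed

text \<open>The arguments differ by \<open>(s' - s) * L\<close>, and the two roots add up to at most
  \<open>4 * L\<close>.\<close>

lemma sqrt_spacing:
  assumes "0 < L" "s < s'" "real (k + s' * L) \<le> 4 * (real L)\<^sup>2"
  shows "sqrt (real (k + s' * L)) - sqrt (real (k + s * L)) \<ge> 1 / 4 * real (s' - s)"
proof -
  define a b where "a = sqrt (real (k + s' * L))" and "b = sqrt (real (k + s * L))"
  have "a \<le> 2 * real L"
    unfolding a_def by (rule real_le_lsqrt) (use assms(3) in \<open>auto simp: power_mult_distrib\<close>)
  have "b \<le> a" using assms(2) by (simp add: a_def b_def mult_right_mono)
  have "(a - b) * (a + b) = a\<^sup>2 - b\<^sup>2" by (simp add: power2_eq_square algebra_simps)
  also have "\<dots> = real (s' - s) * real L"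
    using assms(2) by (simp add: a_def b_def of_nat_diff algebra_simps)
  finally have "real (s' - s) * real L = (a - b) * (a + b)" by simp
  also have "\<dots> \<le> (a - b) * (4 * real L)"
    using \<open>a \<le> 2 * real L\<close> \<open>b \<le> a\<close> by (intro mult_left_mono) auto
  finally have "real (s' - s) * real L \<le> (4 * (a - b)) * real L" by (simp add: mult_ac)
  then have "real (s' - s) \<le> 4 * (a - b)" using assms(1) by simp
  then show ?thesis by (simp add: a_def b_def)
qed

text \<open>One factor \<open>1 / sqrt L\<close> comes from the height of the peaks and another from
  the mixer; together they cancel \<open>2 ^ level n\<close>. The sum over the residue class is
  bounded by separation with \<open>\<delta> = 1 / 4\<close>.\<close>

lemma mix_gaussian_feature_le:
  assumes "\<eta> > 0"
  shows "2 ^ level n * \<bar>mix (gaussian_feature \<eta>) n x\<bar> \<le> exp 2 * (2 / (1 - exp (- (1 / 4)\<^sup>2 / 8)))"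
proof -
  define m L k0 where "m = level n" and "L = (2::nat) ^ m" and "k0 = block_start m + offset n mod 2 ^ m"
  define y where "y = sqrt (2 * x\<^sup>2 / \<eta>)"
  have "L > 0" by (simp add: L_def)
  have L2: "4 ^ m = L * L" by (simp add: L_def flip: power_mult_distrib)
  have le: "real (k0 + s * L) \<le> 4 * (real L)\<^sup>2" if "s < L" for s
  proof -
    have "offset n mod L < L" using \<open>L > 0\<close> by simp
    moreover have "Suc s * L \<le> L * L" using that by (intro mult_right_mono) auto
    ultimately have "k0 + s * L \<le> 4 * (L * L)"
      using block_start_closed[of m] unfolding k0_def L_def[symmetric] L2 by simp
    then have "real (k0 + s * L) \<le> real (4 * (L * L))" by (rule of_nat_mono)
    then show ?thesis by (simp add: power2_eq_square)
  qed
  have bound: "\<bar>gaussian_feature \<eta> (k0 + s * L) x\<bar>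
      \<le> exp 2 / sqrt (real L) * exp (- (y - sqrt (real (k0 + s * L)))\<^sup>2 / 2)" for s
    unfolding y_def
  proof (rule gaussian_feature_le[OF assms \<open>L > 0\<close>])
    show "(L - 1)\<^sup>2 \<le> 4 * (k0 + s * L)"
      using block_start_lower[of m] unfolding k0_def L_def[symmetric] by simp
  qed
  have "\<bar>mix (gaussian_feature \<eta>) n x\<bar> \<le> (\<Sum>s<L. \<bar>gaussian_feature \<eta> (k0 + s * L) x\<bar>) / sqrt (real L)"
    using abs_mix_le[of "gaussian_feature \<eta>" n x] by (simp add: k0_def L_def m_def add.assoc)
  also have "\<dots> \<le> (\<Sum>s<L. exp 2 / sqrt (real L) * exp (- (y - sqrt (real (k0 + s * L)))\<^sup>2 / 2)) / sqrt (real L)"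
    by (intro divide_right_mono sum_mono bound) auto
  also have "\<dots> = exp 2 / real L * (\<Sum>s<L. exp (- (y - sqrt (real (k0 + s * L)))\<^sup>2 / 2))"
    unfolding sum_distrib_left[symmetric] using \<open>L > 0\<close> by (simp add: field_simps)
  also have "\<dots> \<le> exp 2 / real L * (2 / (1 - exp (- (1 / 4)\<^sup>2 / 8)))"
    using sqrt_spacing[OF \<open>L > 0\<close>] le by (intro mult_left_mono exp_half_squares_separated) auto
  finally show ?thesis
    using \<open>L > 0\<close> unfolding m_def[symmetric] by (simp add: field_simps L_def)
qed

text \<open>Block \<open>m\<close> ends before \<open>4 ^ Suc m / 3\<close>, so
  \<open>4 ^ level n\<close> grows at least linearly in \<open>n\<close>.\<close>

lemma inverse_level_le: "1 / 4 ^ level n \<le> 2 / real (Suc n)"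
proof -
  have "Suc n \<le> 2 * 4 ^ level n"
    using level_less[of n] block_start_closed[of "Suc (level n)"] by simp
  then have "real (Suc n) \<le> real (2 * 4 ^ level n)" by (rule of_nat_mono)
  then have "real (Suc n) \<le> 2 * 4 ^ level n" by simp
  then show ?thesis by (simp add: divide_simps del: of_nat_Suc)
qed

lemma gaussian_expansion_UNIV:
  assumes "\<eta> > 0" "p > 1"
  shows "admits_expansion_on p UNIV (gaussian_kernel \<eta>)"
proof -
  \<comment> \<open>This compensates the factor \<open>2 ^ level n\<close> in both copies of
    \<open>\<psi> n\<close>. Being of order \<open>1 / n\<close>, it is p-summable exactly for
    \<open>p > 1\<close>.\<close>
  define \<Lambda> where "\<Lambda> n = (1 / 4 ^ level n :: real)" for n
  define \<psi> where "\<psi> n x = 2 ^ level n * mix (gaussian_feature \<eta>) n x" for n x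
  have eq: "\<Lambda> n * \<psi> n x * \<psi> n y = mix (gaussian_feature \<eta>) n x * mix (gaussian_feature \<eta>) n y" for n x y
  proof -
    have "(4::real) ^ level n = 2 ^ level n * 2 ^ level n" by (simp flip: power_mult_distrib)
    then show ?thesis by (simp add: \<Lambda>_def \<psi>_def)
  qed
  have "(\<lambda>n. \<Lambda> n * \<psi> n x * \<psi> n y) sums gaussian_kernel \<eta> x y" for x y
    unfolding eq by (intro mix_sums gaussian_feature_sums assms)
  moreover have "summable (\<lambda>n. \<Lambda> n powr p)"
  proof (rule summable_comparison_test')
    have "summable (\<lambda>n. real n powr - p)" using assms(2) by (simp add: summable_real_powr_iff)
    then have "summable (\<lambda>n. real (Suc n) powr - p)" by (subst summable_Suc_iff)
    then show "summable (\<lambda>n. 2 powr p * real (Suc n) powr - p)" by (rule summable_mult)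
    show "norm (\<Lambda> n powr p) \<le> 2 powr p * real (Suc n) powr - p" for n
    proof -
      have "\<Lambda> n powr p \<le> (2 / real (Suc n)) powr p"
        unfolding \<Lambda>_def using assms(2) by (intro powr_mono2 inverse_level_le) auto
      then show ?thesis by (simp add: powr_divide powr_minus_divide)
    qed
  qed
  moreover have "linearly_independent_family_on UNIV \<psi>"
  proof -
    have "linearly_independent_family_on UNIV (gaussian_feature \<eta>)"
      unfolding gaussian_feature_def[abs_def]
      using assms(1) by (intro monomials_independent) (auto simp: infinite_UNIV_char_0)
    then have "linearly_independent_family_on UNIV (mix (gaussian_feature \<eta>))"
      by (rule mix_independent)
    then have mix: "\<forall>n\<in>S. c n = 0"
      if "finite S" "\<forall>x. (\<Sum>n\<in>S. c n * mix (gaussian_feature \<eta>) n x) = 0" for S c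
      using that by (simp add: linearly_independent_family_on_def)
    show ?thesis
      unfolding linearly_independent_family_on_def
    proof (intro allI impI)
      fix S and c :: "nat \<Rightarrow> real"
      assume "finite S" "\<forall>x\<in>UNIV. (\<Sum>n\<in>S. c n * \<psi> n x) = 0"
      then show "\<forall>n\<in>S. c n = 0"
        \<comment> \<open>The nonzero rescaling is absorbed into the coefficients.\<close>
        using mix[of S "\<lambda>n. c n * 2 ^ level n"] by (simp add: \<psi>_def mult.assoc)
    qed
  qed
  moreover have "sup_norm_on UNIV (\<psi> n) \<le> ereal (exp 2 * (2 / (1 - exp (- (1 / 4)\<^sup>2 / 8))))" for n
    using mix_gaussian_feature_le[OF assms(1)]
    by (intro sup_norm_on_le) (simp add: \<psi>_def abs_mult)
  ultimately show ?thesis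
    unfolding admits_expansion_on_def by (intro exI[of _ \<Lambda>] exI[of _ \<psi>] conjI) (auto simp: \<Lambda>_def)
qed

theorem proposition2:
  shows "(\<forall>(X :: (real \<times> real) set) (\<eta> :: real). bounded X \<and> \<eta> > 0 \<longrightarrow>
            (\<forall>I :: real set. nondegenerate_interval I \<and> bounded I \<and> X \<subseteq> I \<times> I \<longrightarrow>
               admits_expansion_on 1 I (gaussian_kernel \<eta>)))
       \<and> (\<forall>F :: real \<Rightarrow> real. (F \<longlongrightarrow> 0) at_top \<and>
            psd_kernel_on UNIV (\<lambda>x y. F \<bar>x - y\<bar>) \<and> (\<exists>x y :: real. F \<bar>x - y\<bar> \<noteq> 0) \<longrightarrow>
            \<not> admits_expansion_on 1 UNIV (\<lambda>x y. F \<bar>x - y\<bar>))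
       \<and> (\<forall>(\<eta> :: real) (p :: real). \<eta> > 0 \<and> p > 1 \<longrightarrow>
            admits_expansion_on p UNIV (gaussian_kernel \<eta>))"
proof -
  have "infinite I" if "nondegenerate_interval I" for I
  proof
    assume "finite I"
    then have "interior I = {}" by (rule empty_interior_finite)
    with that show False by (simp add: nondegenerate_interval_def)
  qed
  then show ?thesis
    using gaussian_expansion_bounded vanishing_kernel_no_expansion gaussian_expansion_UNIV by blast
qed

end
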